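(* Let $\alpha,\beta>0$. Then the following properties hold: (i) the dynamic-memory kernels satisfy $\Psi_\alpha * \Psi_\beta=\Psi_{\alpha+\beta}$; (ii) the dynamic-memory fractional integrals satisfy the semigroup property $\mathcal I_\Phi^\alpha\,\mathcal I_\Phi^\beta=\mathcal I_\Phi^{\alpha+\beta}$; (iii) the dynamic-memory fractional integrals commute: $\mathcal I_\Phi^\alpha\,\mathcal I_\Phi^\beta x=\mathcal I_\Phi^\beta\,\mathcal I_\Phi^\alpha x$ for every locally integrable $x$.
   Context: A dynamic memory generator is a positive function $\Phi(p,\Theta)$ of the Laplace variable $p\in(0,\infty)$ and of a collection $\Theta$ of modulation parameters, which is fixed. For $\gamma>0$ the associated dynamic-memory kernel is $\Psi_\gamma(t)=\Psi_\gamma(t;\Theta)=\mathcal L^{-1}\{\Phi(p,\Theta)^{-\gamma}\}(t)$, i.e. the function on $(0,\infty)$ whose Laplace transform is $\int_0^\infty e^{-pt}\Psi_\gamma(t;\Theta)\,dt=\Phi(p,\Theta)^{-\gamma}$, $p>0$. Standing assumption: for every $\gamma>0$ this inverse Laplace transform exists and is a locally integrable function (integrable on $(0,a)$ for every $a>0$). The convolution is $(f*g)(t)=\int_0^t f(t-s)g(s)\,ds$ for locally integrable $f,g$. The dynamic-memory fractional integral of order $\gamma>0$ of a locally integrable function $x$ is $(\mathcal I_\Phi^\gamma x)(t)=\int_0^t\Psi_\gamma(t-s;\Theta)x(s)\,ds$. Equalities are equalities of locally integrable functions. *)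

theory Defs
  imports "HOL-Analysis.Analysis"
begin

definition locally_integrable :: "(real \<Rightarrow> real) \<Rightarrow> bool" where
  "locally_integrable f \<longleftrightarrow> (\<forall>a>0. set_integrable lebesgue {0<..<a} f)"

(* Locally integrable functions on the half-line are identified when they agree almost
   everywhere; values at arguments t \<le> 0 are irrelevant. Local integrability of both
   sides is part of the claim. *)
definition locally_integrable_eq :: "(real \<Rightarrow> real) \<Rightarrow> (real \<Rightarrow> real) \<Rightarrow> bool" where
  "locally_integrable_eq f g \<longleftrightarrow>
     locally_integrable f \<and> locally_integrable g \<and> (AE t in lebesgue. t > 0 \<longrightarrow> f t = g t)"

(* The Laplace integral of a locally integrable function is taken as the limit of the
   integrals over (0, T) for T tending to infinity. Absolutely convergent Laplace
   integrals are a special case. *)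
definition has_laplace :: "(real \<Rightarrow> real) \<Rightarrow> real \<Rightarrow> real \<Rightarrow> bool" where
  "has_laplace f p L \<longleftrightarrow>
     ((\<lambda>T. LINT t:{0<..<T}|lebesgue. exp (- p * t) * f t) \<longlongrightarrow> L) at_top"

definition convolution :: "(real \<Rightarrow> real) \<Rightarrow> (real \<Rightarrow> real) \<Rightarrow> real \<Rightarrow> real" where
  "convolution f g t = (LINT s:{0<..<t}|lebesgue. f (t - s) * g s)"

definition memory_generator :: "(real \<Rightarrow> 'm \<Rightarrow> real) \<Rightarrow> 'm \<Rightarrow> bool" where
  "memory_generator \<Phi> \<Theta> \<longleftrightarrow> (\<forall>p>0. \<Phi> p \<Theta> > 0)"

(* An inverse Laplace transform is determined only up to a null set, so this is a
   predicate on representatives rather than a function of the generator. *)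
definition memory_kernel ::
  "(real \<Rightarrow> 'm \<Rightarrow> real) \<Rightarrow> 'm \<Rightarrow> real \<Rightarrow> (real \<Rightarrow> real) \<Rightarrow> bool" where
  "memory_kernel \<Phi> \<Theta> \<gamma> \<psi> \<longleftrightarrow>
     locally_integrable \<psi> \<and> (\<forall>p>0. has_laplace \<psi> p (\<Phi> p \<Theta> powr (- \<gamma>)))"

definition memory_integral ::
  "(real \<Rightarrow> real \<Rightarrow> real) \<Rightarrow> real \<Rightarrow> (real \<Rightarrow> real) \<Rightarrow> real \<Rightarrow> real" where
  "memory_integral \<Psi> \<gamma> x t = (LINT s:{0<..<t}|lebesgue. \<Psi> \<gamma> (t - s) * x s)"

end

theory Submission
  imports Defs
begin

text \<open>
  Write $*$ for convolution, $1$ for the unit step and $e_p(t) = e^{-pt}$ for $t > 0$. The transform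
  of $f * g$ is the product of the transforms, so $\Psi_\alpha * \Psi_\beta$ ought to have the
  transform $\Phi^{-\alpha}\Phi^{-\beta} = \Phi^{-(\alpha+\beta)}$ of $\Psi_{\alpha+\beta}$, and a
  function is determined by its transform. The difficulty is that the Laplace integrals here may
  converge only conditionally, and then the Laplace integral of $f * g$ need not converge at all.

  Integrating once removes the difficulty. If the Laplace integral of $f$ converges to $F(p)$
  for every $p > 0$, then the primitive $1 * f$ grows more slowly than every exponential
  $e^{pt}$ with $p > 0$, so its Laplace integral converges absolutely, to $F(p)/p$
  (\<open>integrable_damp_primitive\<close> and \<open>laplace_primitive\<close>). Consequently, with $h$ a function of
  transform $F G$, both $(1 * f) * (1 * g)$ and $1 * (1 * h)$ have absolutely convergent transforms,
  equal to $F(p) G(p) / p^2$. Uniqueness for absolutely convergent transforms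
  (\<open>AE_zero_if_laplace_at_naturals_zero\<close>, Lerch's theorem) and the associativity of convolution give
  $1 * (1 * (f * g)) = 1 * (1 * h)$ almost everywhere. Taking primitives is injective up to null sets
  (\<open>AE_eq_if_primitives_AE_eq\<close>), and two cancellations leave $f * g = h$. This is
  \<open>convolution_unique_by_laplace\<close>, which contains part (i).

  The fractional integral of $x$ is $\Psi_\gamma * x$. Hence the semigroup property is (i) together
  with the associativity $\Psi_\alpha * (\Psi_\beta * x) = (\Psi_\alpha * \Psi_\beta) * x$, and
  commutation follows because $\alpha + \beta = \beta + \alpha$.

  Composition with $(t, s) \mapsto t - s$ preserves Borel measurability, so that Fubini's theorem applies
  directly to convolution integrals of Borel functions. For this reason the analysis is carried out for Borel functions that
  vanish on $(-\infty, 0]$, and the last step passes from Lebesgue measurable functions to Borel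
  representatives; convolutions do not see the change.
\<close>

section \<open>Integrable functions on the line and Fubini\<close>

text \<open>
  Integrating over $t$ first removes the translation, which leaves the product of the two integrals.
  The parameter space $M$ is arbitrary so that the lemma serves both for a single convolution
  ($M$ the line) and for a double one ($M$ the plane, $c$ the first projection).
\<close>
lemma integrable_translate_mult:
  fixes f :: "real \<Rightarrow> real" and g c :: "'a \<Rightarrow> real"
  assumes "sigma_finite_measure M" and f: "integrable lborel f" and g: "integrable M g"
    and c [measurable]: "c \<in> borel_measurable M"
  shows "integrable (lborel \<Otimes>\<^sub>M M) (\<lambda>(t, y). f (t - c y) * g y)"
proof -
  interpret M: sigma_finite_measure M by fact
  interpret pair_sigma_finite M lborel
    by (intro pair_sigma_finite.intro) (simp_all add: M.sigma_finite_measure_axioms lborel.sigma_finite_measure_axioms)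
  have [measurable]: "f \<in> borel_measurable borel" "g \<in> borel_measurable M"
    using f g by auto
  have shift: "integrable lborel (\<lambda>t. f (t - s))" for s
    using lborel_integrable_real_affine[OF f, of 1 "- s"] by simp
  have norm: "(\<integral>t. \<bar>f (t - s)\<bar> \<partial>lborel) = (\<integral>t. \<bar>f t\<bar> \<partial>lborel)" for s
    using lborel_integral_real_affine[of 1 "\<lambda>t. \<bar>f t\<bar>" "- s"] by simp
  have "integrable (M \<Otimes>\<^sub>M lborel) (\<lambda>(y, t). f (t - c y) * g y)"
  proof (rule Fubini_integrable)
    show "integrable M (\<lambda>y. \<integral>t. norm (case (y, t) of (y, t) \<Rightarrow> f (t - c y) * g y) \<partial>lborel)"
      using g by (simp add: abs_mult norm)
    show "AE y in M. integrable lborel (\<lambda>t. case (y, t) of (y, t) \<Rightarrow> f (t - c y) * g y)"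
      using shift by simp
  qed measurable
  then show ?thesis
    by (simp add: integrable_product_swap_iff[symmetric] split_beta')
qed

definition line_convolution :: "(real \<Rightarrow> real) \<Rightarrow> (real \<Rightarrow> real) \<Rightarrow> real \<Rightarrow> real"  (infixr "\<star>" 70)
  where "(f \<star> g) t = (\<integral>s. f (t - s) * g s \<partial>lborel)"

lemma line_convolution_measurable [measurable]:
  assumes [measurable]: "f \<in> borel_measurable borel" "g \<in> borel_measurable borel"
  shows "f \<star> g \<in> borel_measurable borel"
  unfolding line_convolution_def[abs_def] by measurable

lemma line_convolution_commute: "f \<star> g = g \<star> f"
proof
  fix t
  show "(f \<star> g) t = (g \<star> f) t"
    using lborel_integral_real_affine[of "-1" "\<lambda>s. f (t - s) * g s" t]
    by (simp add: line_convolution_def mult.commute)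
qed

lemma
  assumes f: "integrable lborel f" and g: "integrable lborel g"
  shows integrable_line_convolution: "integrable lborel (f \<star> g)"
    and integral_line_convolution:
      "(\<integral>t. (f \<star> g) t \<partial>lborel) = (\<integral>t. f t \<partial>lborel) * (\<integral>t. g t \<partial>lborel)"
proof -
  have *: "integrable (lborel \<Otimes>\<^sub>M lborel) (\<lambda>(t, s). f (t - s) * g s)"
    using integrable_translate_mult[OF lborel.sigma_finite_measure_axioms f g, of "\<lambda>s. s"] by simp
  show "integrable lborel (f \<star> g)"
    using lborel_pair.integrable_fst'[OF *] by (simp add: line_convolution_def[abs_def])
  have shift: "(\<integral>t. f (t - s) \<partial>lborel) = (\<integral>t. f t \<partial>lborel)" for s
    using lborel_integral_real_affine[of 1 f "- s"] by simp
  have "(\<integral>t. (f \<star> g) t \<partial>lborel) = (\<integral>s. (\<integral>t. f (t - s) * g s \<partial>lborel) \<partial>lborel)"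
    using lborel_pair.Fubini_integral[OF *] by (simp add: line_convolution_def)
  also have "\<dots> = (\<integral>s. (\<integral>t. f t \<partial>lborel) * g s \<partial>lborel)"
    by (simp add: shift)
  finally show "(\<integral>t. (f \<star> g) t \<partial>lborel) = (\<integral>t. f t \<partial>lborel) * (\<integral>t. g t \<partial>lborel)"
    by simp
qed

text \<open>
  Both sides are iterated integrals of $f(t-s)\,g(s-r)\,h(r)$ over the $(s,r)$ plane, taken in opposite
  orders. The equality holds only for almost every $t$, because for the other $t$ this function of
  $(s,r)$ need not be integrable.
\<close>
lemma line_convolution_assoc:
  assumes f: "integrable lborel f" and g: "integrable lborel g" and h: "integrable lborel h"
  shows "AE t in lborel. (f \<star> (g \<star> h)) t = ((f \<star> g) \<star> h) t"
proof -
  let ?L = "lborel :: real measure"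
  have pair: "sigma_finite_measure (?L \<Otimes>\<^sub>M ?L)"
    by (intro sigma_finite_pair_measure lborel.sigma_finite_measure_axioms)
  interpret T: pair_sigma_finite ?L "?L \<Otimes>\<^sub>M ?L"
    by (intro pair_sigma_finite.intro pair lborel.sigma_finite_measure_axioms)
  have "integrable (?L \<Otimes>\<^sub>M ?L) (\<lambda>(s, r). g (s - r) * h r)"
    using integrable_translate_mult[OF lborel.sigma_finite_measure_axioms g h, of "\<lambda>r. r"] by simp
  from integrable_translate_mult[OF pair f this, of fst]
  have "integrable (?L \<Otimes>\<^sub>M (?L \<Otimes>\<^sub>M ?L)) (\<lambda>(t, s, r). f (t - s) * (g (s - r) * h r))"
    by (simp add: split_beta')
  from T.AE_integrable_fst'[OF this]
  have "AE t in ?L. integrable (?L \<Otimes>\<^sub>M ?L) (\<lambda>(s, r). f (t - s) * (g (s - r) * h r))"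
    by simp
  then show ?thesis
  proof eventually_elim
    case (elim t)
    have "(f \<star> (g \<star> h)) t = (\<integral>s. (\<integral>r. f (t - s) * (g (s - r) * h r) \<partial>?L) \<partial>?L)"
      by (simp add: line_convolution_def)
    also have "\<dots> = (\<integral>r. (\<integral>s. f (t - s) * (g (s - r) * h r) \<partial>?L) \<partial>?L)"
      by (rule lborel_pair.Fubini_integral[OF elim, symmetric])
    \<comment> \<open>In the inner integral substitute $s + r$ for $s$.\<close>
    also have "\<dots> = (\<integral>r. (\<integral>s. f ((t - r) - s) * g s \<partial>?L) * h r \<partial>?L)"
    proof (rule Bochner_Integration.integral_cong[OF refl])
      fix r
      have "(\<integral>s. f (t - s) * (g (s - r) * h r) \<partial>?L) = (\<integral>s. f ((t - r) - s) * g s * h r \<partial>?L)"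
        using lborel_integral_real_affine[of 1 "\<lambda>s. f (t - s) * (g (s - r) * h r)" r]
        by (simp add: diff_diff_eq mult.assoc del: integral_mult_left_zero)
      then show "(\<integral>s. f (t - s) * (g (s - r) * h r) \<partial>?L) = (\<integral>s. f ((t - r) - s) * g s \<partial>?L) * h r"
        by simp
    qed
    finally show ?case by (simp add: line_convolution_def)
  qed
qed

text \<open>
  The conclusion holds at every point, since a null set stays null under reflection and translation.
\<close>
lemma line_convolution_cong_AE:
  assumes [measurable]: "f \<in> borel_measurable borel" "f' \<in> borel_measurable borel"
      "g \<in> borel_measurable borel"
    and eq: "AE t in lborel. f t = f' t"
  shows "f \<star> g = f' \<star> g"
proof
  fix t
  have "AE s in lborel. f (t + (-1) * s) = f' (t + (-1) * s)"
    by (rule AE_borel_affine) (use eq in auto)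
  then show "(f \<star> g) t = (f' \<star> g) t"
    unfolding line_convolution_def by (intro integral_cong_AE) auto
qed

text \<open>
  The positive and the negative part of $w$ are densities of two finite measures that agree on rays.
  Rays generate the Borel sets, so the measures coincide and so do their densities.
\<close>
lemma AE_zero_if_integrals_over_rays_zero:
  fixes w :: "real \<Rightarrow> real"
  assumes w: "integrable lborel w"
    and zero: "\<And>x. (\<integral>t. indicator {x<..} t * w t \<partial>lborel) = 0"
  shows "AE t in lborel. w t = 0"
proof -
  have [measurable]: "w \<in> borel_measurable borel" using w by auto
  define p where "p t = max 0 (w t)" for t
  define m where "m t = max 0 (- w t)" for t
  have int: "integrable lborel p" "integrable lborel m"
    using w unfolding p_def m_def by auto
  have [measurable]: "p \<in> borel_measurable borel" "m \<in> borel_measurable borel"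
    unfolding p_def m_def by measurable
  have ray: "integrable lborel (\<lambda>t. indicator {x<..} t * p t)" "integrable lborel (\<lambda>t. indicator {x<..} t * m t)" for x
    using integrable_mult_indicator[OF _ int(1), of "{x<..}"] integrable_mult_indicator[OF _ int(2), of "{x<..}"]
    by auto
  have nn: "0 \<le> p t" "0 \<le> m t" for t unfolding p_def m_def by auto
  have em: "emeasure (density lborel (\<lambda>t. ennreal (k t))) {x<..} = ennreal (\<integral>t. indicator {x<..} t * k t \<partial>lborel)"
    if "k \<in> borel_measurable borel" "\<And>t. 0 \<le> k t" "integrable lborel (\<lambda>t. indicator {x<..} t * k t)"
    for k :: "real \<Rightarrow> real" and x
  proof -
    have "emeasure (density lborel (\<lambda>t. ennreal (k t))) {x<..} = (\<integral>\<^sup>+t. ennreal (indicator {x<..} t * k t) \<partial>lborel)"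
      using that(1) by (subst emeasure_density) (auto intro!: nn_integral_cong simp: indicator_def)
    also have "\<dots> = ennreal (\<integral>t. indicator {x<..} t * k t \<partial>lborel)"
      using that by (intro nn_integral_eq_integral) auto
    finally show ?thesis .
  qed
  have eq: "(\<integral>t. indicator {x<..} t * p t \<partial>lborel) = (\<integral>t. indicator {x<..} t * m t \<partial>lborel)" for x
  proof -
    have "w t = p t - m t" for t unfolding p_def m_def by auto
    then show ?thesis
      using zero[of x] ray[of x] by (simp add: right_diff_distrib)
  qed
  have "density lborel (\<lambda>t. ennreal (p t)) = density lborel (\<lambda>t. ennreal (m t))"
    by (rule measure_eqI_lessThan) (simp_all add: em nn ray eq)
  then have "AE t in lborel. ennreal (p t) = ennreal (m t)"
    by (intro sigma_finite_measure.density_unique[OF lborel.sigma_finite_measure_axioms]) auto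
  then show ?thesis
    by eventually_elim (use nn in \<open>auto simp: p_def m_def max_def split: if_splits\<close>)
qed

lemma AE_lborel_obtains_between:
  fixes a b :: real
  assumes "AE t in lborel. P t" and "a < b"
  obtains t where "a < t" "t < b" "P t"
proof (rule ccontr)
  assume *: "\<not> thesis"
  have "AE t in lborel. t \<notin> {a<..<b}"
    using assms(1) by eventually_elim (use * that in auto)
  then have "{a<..<b} \<in> null_sets lborel"
    by (subst AE_iff_null_sets) auto
  then show False using \<open>a < b\<close> by (simp add: null_sets_def)
qed

section \<open>Causal functions\<close>

text \<open>
  A Borel function on the line that stands for a locally integrable function on the half-line. It is
  extended by zero, so that the convolution integral over $(0,t)$ becomes one over the whole line.
\<close>
definition causal :: "(real \<Rightarrow> real) \<Rightarrow> bool" where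
  "causal f \<longleftrightarrow> f \<in> borel_measurable borel \<and> (\<forall>t\<le>0. f t = 0) \<and>
     (\<forall>a. integrable lborel (\<lambda>t. indicator {..<a} t * f t))"

abbreviation trunc :: "real \<Rightarrow> (real \<Rightarrow> real) \<Rightarrow> real \<Rightarrow> real" where
  "trunc a f \<equiv> \<lambda>t. indicator {..<a} t * f t"

lemma causalD:
  assumes "causal f"
  shows "f \<in> borel_measurable borel" "t \<le> 0 \<Longrightarrow> f t = 0" "integrable lborel (trunc a f)"
  using assms by (auto simp: causal_def)

text \<open>
  Up to time $a$ a convolution sees its factors only up to time $a$. This reduces local statements to
  statements on integrable functions.
\<close>
lemma line_convolution_trunc:
  assumes f: "causal f" and g: "causal g" and "t < a"
  shows "(trunc a f \<star> trunc a g) t = (f \<star> g) t"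
  unfolding line_convolution_def
proof (rule Bochner_Integration.integral_cong[OF refl])
  fix s
  show "indicator {..<a} (t - s) * f (t - s) * (indicator {..<a} s * g s) = f (t - s) * g s"
    using causalD(2)[OF f, of "t - s"] causalD(2)[OF g, of s] \<open>t < a\<close>
    by (auto simp: indicator_def)
qed

lemma line_convolution_nonpos:
  assumes f: "causal f" and g: "causal g" and "t \<le> 0"
  shows "(f \<star> g) t = 0"
proof -
  have "(\<lambda>s. f (t - s) * g s) = (\<lambda>s. 0)"
  proof
    fix s
    show "f (t - s) * g s = 0"
      using causalD(2)[OF f, of "t - s"] causalD(2)[OF g, of s] \<open>t \<le> 0\<close> by (cases "s \<le> 0") auto
  qed
  then show ?thesis unfolding line_convolution_def by simp
qed

lemma causal_line_convolution:
  assumes f: "causal f" and g: "causal g"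
  shows "causal (f \<star> g)"
  unfolding causal_def
proof (intro conjI allI impI)
  note [measurable] = causalD(1)[OF f] causalD(1)[OF g]
  show "f \<star> g \<in> borel_measurable borel" by measurable
  show "(f \<star> g) t = 0" if "t \<le> 0" for t by (rule line_convolution_nonpos[OF f g that])
  fix a
  have "integrable lborel (\<lambda>t. indicator {..<a} t *\<^sub>R (trunc a f \<star> trunc a g) t)"
    by (rule integrable_mult_indicator[OF _ integrable_line_convolution[OF causalD(3)[OF f] causalD(3)[OF g]]]) simp
  moreover have "indicator {..<a} t *\<^sub>R (trunc a f \<star> trunc a g) t = trunc a (f \<star> g) t" for t
    using line_convolution_trunc[OF f g, of t a] by (cases "t < a") simp_all
  ultimately show "integrable lborel (trunc a (f \<star> g))"
    by (simp only:)
qed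

lemma causal_line_convolution_assoc:
  assumes f: "causal f" and g: "causal g" and h: "causal h"
  shows "AE t in lborel. (f \<star> (g \<star> h)) t = ((f \<star> g) \<star> h) t"
proof -
  have cong: "(k \<star> trunc a u) t = (k \<star> trunc a v) t"
    if "\<And>s. s < a \<Longrightarrow> u s = v s" for k u v :: "real \<Rightarrow> real" and a t
    unfolding line_convolution_def
    by (rule Bochner_Integration.integral_cong[OF refl]) (simp add: indicator_def that)
  have drop: "(trunc a k \<star> trunc a u) t = (trunc a k \<star> u) t"
    if "t < a" "causal k" for k u :: "real \<Rightarrow> real" and a t
    unfolding line_convolution_def
  proof (rule Bochner_Integration.integral_cong[OF refl])
    fix s
    show "trunc a k (t - s) * trunc a u s = trunc a k (t - s) * u s"
      using \<open>t < a\<close> causalD(2)[OF \<open>causal k\<close>, of "t - s"] by (cases "s < a") simp_all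
  qed
  have "AE t in lborel. \<forall>n::nat. (trunc n f \<star> (trunc n g \<star> trunc n h)) t = ((trunc n f \<star> trunc n g) \<star> trunc n h) t"
    unfolding AE_all_countable
    by (intro allI line_convolution_assoc causalD(3)[OF f] causalD(3)[OF g] causalD(3)[OF h])
  then show ?thesis
  proof eventually_elim
    case (elim t)
    obtain n :: nat where n: "t < n" using reals_Archimedean2 by blast
    have "(f \<star> (g \<star> h)) t = (trunc n f \<star> trunc n (g \<star> h)) t"
      using line_convolution_trunc[OF f causal_line_convolution[OF g h] n] by simp
    also have "\<dots> = (trunc n f \<star> trunc n (trunc n g \<star> trunc n h)) t"
      by (rule cong) (simp add: line_convolution_trunc[OF g h])
    also have "\<dots> = (trunc n f \<star> (trunc n g \<star> trunc n h)) t"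
      by (rule drop[OF n f])
    also have "\<dots> = (trunc n h \<star> (trunc n f \<star> trunc n g)) t"
      by (subst line_convolution_commute[of "trunc n h"]) (rule elim[rule_format])
    also have "\<dots> = (trunc n h \<star> trunc n (trunc n f \<star> trunc n g)) t"
      by (rule drop[OF n h, symmetric])
    also have "\<dots> = (trunc n h \<star> trunc n (f \<star> g)) t"
      by (rule cong) (simp add: line_convolution_trunc[OF f g])
    also have "\<dots> = (h \<star> (f \<star> g)) t"
      by (rule line_convolution_trunc[OF h causal_line_convolution[OF f g] n])
    finally show ?case by (subst line_convolution_commute[of "f \<star> g"])
  qed
qed

section \<open>Primitives and exponential damping\<close>

text \<open>
  Convolution with the unit step is integration from $0$. Taking primitives is thereby covered by the
  algebra of convolution.
\<close>
definition unit_step :: "real \<Rightarrow> real" where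
  "unit_step = indicator {0<..}"

definition damp :: "real \<Rightarrow> (real \<Rightarrow> real) \<Rightarrow> real \<Rightarrow> real" where
  "damp p f t = exp (- p * t) * f t"

lemma unit_step_convolution:
  assumes "causal f"
  shows "(unit_step \<star> f) t = (\<integral>s. indicator {..<t} s * f s \<partial>lborel)"
  unfolding line_convolution_def unit_step_def
  by (rule Bochner_Integration.integral_cong) (auto simp: indicator_def)

lemma causal_damp:
  assumes f: "causal f"
  shows "causal (damp p f)"
  unfolding causal_def
proof (intro conjI allI impI)
  note [measurable] = causalD(1)[OF f]
  show "damp p f \<in> borel_measurable borel" unfolding damp_def[abs_def] by measurable
  show "damp p f t = 0" if "t \<le> 0" for t using causalD(2)[OF f that] by (simp add: damp_def)
  fix a
  have "integrable lborel (\<lambda>t. exp (\<bar>p\<bar> * \<bar>a\<bar>) * trunc a f t)"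
    by (intro integrable_mult_right causalD(3)[OF f])
  then show "integrable lborel (trunc a (damp p f))"
  proof (rule Bochner_Integration.integrable_bound)
    show "trunc a (damp p f) \<in> borel_measurable lborel" unfolding damp_def[abs_def] by measurable
    have "exp (- p * t) \<le> exp (\<bar>p\<bar> * \<bar>a\<bar>)" if "0 < t" "t < a" for t
    proof -
      have "- p * t \<le> \<bar>p\<bar> * t" using that by (intro mult_right_mono) auto
      also have "\<dots> \<le> \<bar>p\<bar> * \<bar>a\<bar>" using that by (intro mult_left_mono) auto
      finally show ?thesis by simp
    qed
    then have "norm (trunc a (damp p f) t) \<le> norm (exp (\<bar>p\<bar> * \<bar>a\<bar>) * trunc a f t)" for t
      using causalD(2)[OF f, of t]
      by (cases "t \<le> 0") (auto simp: damp_def indicator_def abs_mult intro!: mult_right_mono)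
    then show "AE t in lborel. norm (trunc a (damp p f) t) \<le> norm (exp (\<bar>p\<bar> * \<bar>a\<bar>) * trunc a f t)"
      by simp
  qed
qed

lemma causal_unit_step: "causal unit_step"
  unfolding causal_def unit_step_def
proof (intro conjI allI impI)
  fix a :: real
  have "(\<lambda>t::real. indicator {..<a} t * indicator {0<..} t) = (indicator {0<..<a} :: real \<Rightarrow> real)"
    by (auto simp: indicator_def)
  moreover have "integrable lborel (indicator {0<..<a} :: real \<Rightarrow> real)"
    by (cases "0 \<le> a") (auto intro!: integrable_real_indicator)
  ultimately show "integrable lborel (\<lambda>t::real. indicator {..<a} t * indicator {0<..} t :: real)"
    by simp
qed auto

text \<open>
  Damping is multiplicative because $e^{-pt} = e^{-p(t-s)} e^{-ps}$. Together with
  \<open>integral_line_convolution\<close> this is the product rule for Laplace transforms.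
\<close>
lemma damp_line_convolution: "damp p (f \<star> g) = damp p f \<star> damp p g"
proof
  fix t
  have "exp (- p * (t - s)) * f (t - s) * (exp (- p * s) * g s) = exp (- p * t) * (f (t - s) * g s)" for s
  proof -
    have e: "exp (- p * t) = exp (- p * (t - s)) * exp (- p * s)"
      by (simp add: exp_add[symmetric] algebra_simps)
    show ?thesis unfolding e by (simp only: ac_simps)
  qed
  then show "damp p (f \<star> g) t = (damp p f \<star> damp p g) t"
    by (simp only: damp_def line_convolution_def integral_mult_right_zero)
qed

lemma exp_decay:
  fixes p :: real
  assumes "0 < p"
  shows "((\<lambda>t. exp (- p * t)) \<longlongrightarrow> 0) at_top"
  by (rule filterlim_compose[OF exp_at_bot filterlim_tendsto_neg_mult_at_bot[OF tendsto_const _ filterlim_ident]])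
    (use assms in simp)

lemma damp_unit_step_integral:
  assumes "0 < p"
  shows "integrable lborel (damp p unit_step)" "(\<integral>t. damp p unit_step t \<partial>lborel) = 1 / p"
proof -
  note [measurable] = causalD(1)[OF causal_damp[OF causal_unit_step]]
  have lim: "((\<lambda>t. - exp (- p * t) / p) \<longlongrightarrow> 0) at_top"
    using tendsto_divide[OF tendsto_minus[OF exp_decay[OF assms]] tendsto_const[of p]] assms by simp
  have "(\<integral>\<^sup>+t. ennreal (damp p unit_step t) \<partial>lborel) = (\<integral>\<^sup>+t. ennreal (exp (- p * t)) * indicator {0..} t \<partial>lborel)"
    using AE_lborel_singleton[of "0::real"]
    by (intro nn_integral_cong_AE, eventually_elim) (auto simp: damp_def unit_step_def indicator_def)
  also have "\<dots> = ennreal (0 - (- exp (- p * 0) / p))"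
    using assms by (intro nn_integral_FTC_atLeast lim) (auto intro!: derivative_eq_intros)
  finally have *: "(\<integral>\<^sup>+t. ennreal (damp p unit_step t) \<partial>lborel) = ennreal (1 / p)" by simp
  have nn: "AE t in lborel. 0 \<le> damp p unit_step t" by (simp add: damp_def unit_step_def)
  show "integrable lborel (damp p unit_step)"
    by (rule integrableI_nn_integral_finite[OF _ nn *]) simp
  show "(\<integral>t. damp p unit_step t \<partial>lborel) = 1 / p"
    using * assms by (subst integral_eq_nn_integral[OF _ nn]) auto
qed

lemma resolvent_unit_step:
  assumes "0 < p"
  shows "(damp p unit_step \<star> unit_step) t = (unit_step t - damp p unit_step t) / p"
proof (cases "t \<le> 0")
  case True
  then show ?thesis
    using line_convolution_nonpos[OF causal_damp[OF causal_unit_step] causal_unit_step True]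
    by (simp add: damp_def unit_step_def)
next
  case False
  note E = causal_damp[OF causal_unit_step, of p]
  have "(damp p unit_step \<star> unit_step) t = (\<integral>s. indicator {..<t} s * damp p unit_step s \<partial>lborel)"
    using unit_step_convolution[OF E] by (simp add: line_convolution_commute[of _ unit_step])
  also have "\<dots> = (\<integral>s. indicator {0..t} s *\<^sub>R exp (- p * s) \<partial>lborel)"
  proof (rule integral_cong_AE)
    show "AE s in lborel. indicator {..<t} s * damp p unit_step s = indicator {0..t} s *\<^sub>R exp (- p * s)"
      using AE_lborel_singleton[of "0::real"] AE_lborel_singleton[of t]
      by eventually_elim (auto simp: damp_def unit_step_def indicator_def)
  qed (use causalD(1)[OF E] in measurable)
  also have "\<dots> = - exp (- p * t) / p - (- exp (- p * 0) / p)"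
    using assms False
    by (intro integral_FTC_atLeastAtMost) (auto intro!: derivative_eq_intros continuous_intros simp: has_real_derivative_iff_has_vector_derivative[symmetric])
  finally show ?thesis
    using False assms by (simp add: damp_def unit_step_def field_simps)
qed

text \<open>
  If one factor is bounded, the convolution integral converges absolutely at every point $t$, and not
  merely at almost every one.
\<close>
lemma bounded_line_convolution_integrable:
  assumes f: "causal f" and g: "causal g" and "\<And>t. \<bar>f t\<bar> \<le> C"
  shows "integrable lborel (\<lambda>s. f (t - s) * g s)"
proof -
  note [measurable] = causalD(1)[OF f] causalD(1)[OF g]
  have "integrable lborel (\<lambda>s. C * trunc t g s)"
    by (intro integrable_mult_right causalD(3)[OF g])
  then show ?thesis
  proof (rule Bochner_Integration.integrable_bound)
    have "0 \<le> C" using assms(3)[of 0] by simp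
    then have "norm (f (t - s) * g s) \<le> norm (C * trunc t g s)" for s
      using causalD(2)[OF f, of "t - s"] assms(3)[of "t - s"]
      by (cases "s < t") (auto simp: abs_mult intro!: mult_right_mono)
    then show "AE s in lborel. norm (f (t - s) * g s) \<le> norm (C * trunc t g s)" by simp
  qed measurable
qed

text \<open>
  Convolved with $f$, the identity $p\,(e_p * 1) = 1 - e_p$ becomes an integration by parts: it
  relates $e_p * f$ to $e_p * (1 * f)$ and to $1 * (e_p * f)$, depending on how the product is
  bracketed.
\<close>
lemma resolvent_unit_step_convolution:
  assumes f: "causal f" and "0 < p"
  shows "p * ((damp p unit_step \<star> unit_step) \<star> f) t = (unit_step \<star> f) t - (damp p unit_step \<star> f) t"
proof -
  note E = causal_damp[OF causal_unit_step, of p]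
  have i1: "integrable lborel (\<lambda>s. unit_step (t - s) * f s)"
    by (rule bounded_line_convolution_integrable[OF causal_unit_step f, of 1]) (simp add: unit_step_def)
  have i2: "integrable lborel (\<lambda>s. damp p unit_step (t - s) * f s)"
    by (rule bounded_line_convolution_integrable[OF E f, of 1]) (use \<open>0 < p\<close> in \<open>simp add: damp_def unit_step_def indicator_def\<close>)
  have "((damp p unit_step \<star> unit_step) \<star> f) t
      = (\<integral>s. (unit_step (t - s) * f s - damp p unit_step (t - s) * f s) / p \<partial>lborel)"
    unfolding line_convolution_def[of "damp p unit_step \<star> unit_step"] resolvent_unit_step[OF \<open>0 < p\<close>]
    by (rule Bochner_Integration.integral_cong[OF refl]) (simp add: left_diff_distrib diff_divide_distrib)
  also have "\<dots> = ((unit_step \<star> f) t - (damp p unit_step \<star> f) t) / p"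
    by (simp only: line_convolution_def integral_divide_zero Bochner_Integration.integral_diff[OF i1 i2])
  finally show ?thesis
    using \<open>0 < p\<close> by simp
qed

section \<open>Primitives have absolutely convergent Laplace integrals\<close>

text \<open>
  Let $J = 1 * f$ and $q = p/2$. The function $A(t) = \int_0^t e^{-qs} f(s)\,ds$ has a limit, so it is
  bounded, say by $C$. Integration by parts gives $e^{-qt} J(t) = A(t) - q\,(e_q * A)(t)$, which is at
  most $2C$ in absolute value. Since $p > q$, the function $e^{-pt} J(t)$ is integrable. A second
  integration by parts, $p \int_0^T e^{-pt} J(t)\,dt = \int_0^T e^{-pt} f(t)\,dt - e^{-pT} J(T)$, yields
  the value of the integral as $T$ tends to infinity.
\<close>
lemma
  assumes f: "causal f"
    and conv: "\<And>p. 0 < p \<Longrightarrow> ((\<lambda>T. (unit_step \<star> damp p f) T) \<longlongrightarrow> L p) at_top"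
    and "0 < p"
  shows integrable_damp_primitive: "integrable lborel (damp p (unit_step \<star> f))"
    and laplace_primitive: "(\<integral>t. damp p (unit_step \<star> f) t \<partial>lborel) = L p / p"
proof -
  define q where "q = p / 2"
  have q: "0 < q" using \<open>0 < p\<close> by (simp add: q_def)
  note H = causal_unit_step
  note E = causal_damp[OF causal_unit_step]
  note D = causal_damp[OF f]
  define A where "A = unit_step \<star> damp q f"
  have A: "causal A" unfolding A_def by (rule causal_line_convolution[OF H D])
  note [measurable] = causalD(1)[OF A] causalD(1)[OF f] causalD(1)[OF H] causalD(1)[OF E] causalD(1)[OF D]
  \<comment> \<open>Close to its limit $A$ is bounded; before that, the integral of the absolute value bounds it.\<close>
  obtain C where C: "\<And>t. \<bar>A t\<bar> \<le> C"
  proof -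
    have "eventually (\<lambda>T. dist (A T) (L q) < 1) at_top"
      using conv[OF q] unfolding A_def by (rule tendstoD) simp
    then obtain T0 where T0: "\<And>T. T0 \<le> T \<Longrightarrow> \<bar>A T - L q\<bar> < 1"
      by (auto simp: eventually_at_top_linorder dist_real_def)
    define B where "B = (\<integral>s. \<bar>trunc T0 (damp q f) s\<bar> \<partial>lborel)"
    have "\<bar>A t\<bar> \<le> B" if "t < T0" for t
    proof -
      have "\<bar>A t\<bar> \<le> (\<integral>s. \<bar>trunc t (damp q f) s\<bar> \<partial>lborel)"
        unfolding A_def unit_step_convolution[OF D]
        by (rule integral_abs_bound)
      also have "\<dots> \<le> B" unfolding B_def
        by (intro integral_mono integrable_abs causalD(3)[OF D]) (use that in \<open>auto simp: indicator_def\<close>)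
      finally show ?thesis .
    qed
    moreover have "0 \<le> B" unfolding B_def by simp
    ultimately have "\<bar>A t\<bar> \<le> \<bar>L q\<bar> + 1 + B" for t
      using T0[of t] by (cases "t < T0") force+
    then show thesis by (rule that)
  qed
  have EA: "\<bar>q * (damp q unit_step \<star> A) t\<bar> \<le> C" for t
  proof -
    have "0 \<le> C" using C[of 0] by simp
    have i: "integrable lborel (\<lambda>s. C * damp q unit_step s)"
      by (intro integrable_mult_right damp_unit_step_integral q)
    have "\<bar>(damp q unit_step \<star> A) t\<bar> = \<bar>\<integral>s. A (t - s) * damp q unit_step s \<partial>lborel\<bar>"
      by (simp add: line_convolution_commute[of _ A] line_convolution_def)
    also have "\<dots> \<le> (\<integral>s. C * damp q unit_step s \<partial>lborel)"
    proof (rule order_trans[OF integral_abs_bound integral_mono_AE'[OF i]])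
      show "AE s in lborel. \<bar>A (t - s) * damp q unit_step s\<bar> \<le> C * damp q unit_step s"
        using C by (auto simp: abs_mult damp_def unit_step_def intro!: mult_right_mono)
      show "AE s in lborel. 0 \<le> C * damp q unit_step s"
        using \<open>0 \<le> C\<close> by (simp add: damp_def unit_step_def)
    qed
    also have "\<dots> = C / q" using damp_unit_step_integral(2)[OF q] by simp
    finally show ?thesis using q by (simp add: abs_mult field_simps)
  qed
  define J where "J = unit_step \<star> f"
  have J: "causal J" unfolding J_def by (rule causal_line_convolution[OF H f])
  have dJ: "damp r J = damp r unit_step \<star> damp r f" for r
    unfolding J_def by (rule damp_line_convolution)
  note [measurable] = causalD(1)[OF J] causalD(1)[OF causal_damp[OF J]]
  have bound: "AE t in lborel. \<bar>damp q J t\<bar> \<le> 2 * C"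
    using causal_line_convolution_assoc[OF E[of q] H D[of q]]
  proof eventually_elim
    case (elim t)
    then show ?case
      using resolvent_unit_step_convolution[OF D[of q] q, of t] EA[of t] C[of t]
      unfolding A_def dJ by simp
  qed
  have dom: "AE t in lborel. \<bar>damp p J t\<bar> \<le> 2 * C * damp q unit_step t"
    using bound
  proof eventually_elim
    case (elim t)
    show ?case
    proof (cases "t \<le> 0")
      case True
      then show ?thesis
        using causalD(2)[OF J True] by (simp add: damp_def unit_step_def)
    next
      case False
      have "exp (- p * t) = exp (- q * t) * exp (- q * t)"
        by (simp add: exp_add[symmetric] q_def)
      then have "\<bar>damp p J t\<bar> = exp (- q * t) * \<bar>damp q J t\<bar>"
        by (simp add: damp_def abs_mult)
      also have "\<dots> \<le> exp (- q * t) * (2 * C)"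
        using elim by (intro mult_left_mono) auto
      finally show ?thesis
        using False by (simp add: damp_def unit_step_def mult.commute)
    qed
  qed
  have int: "integrable lborel (damp p J)"
  proof (rule Bochner_Integration.integrable_bound)
    show "integrable lborel (\<lambda>t. 2 * C * damp q unit_step t)"
      by (intro integrable_mult_right damp_unit_step_integral q)
    show "AE t in lborel. norm (damp p J t) \<le> norm (2 * C * damp q unit_step t)"
      using dom by eventually_elim auto
  qed measurable
  then show "integrable lborel (damp p (unit_step \<star> f))" by (simp add: J_def)

  have id: "AE t in lborel. p * (unit_step \<star> damp p J) t = (unit_step \<star> damp p f) t - damp p J t"
    using causal_line_convolution_assoc[OF H E[of p] D[of p]]
    by eventually_elim
      (use resolvent_unit_step_convolution[OF D[of p] \<open>0 < p\<close>] in \<open>simp add: dJ line_convolution_commute[of unit_step "damp p unit_step"]\<close>)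
  \<comment> \<open>The two facts hold only almost everywhere, so the limit is taken along a sequence of good points.\<close>
  have both: "AE t in lborel. \<bar>damp p J t\<bar> \<le> 2 * C * damp q unit_step t \<and>
      p * (unit_step \<star> damp p J) t = (unit_step \<star> damp p f) t - damp p J t"
    using dom id by eventually_elim simp
  have "\<exists>t. real n < t \<and> \<bar>damp p J t\<bar> \<le> 2 * C * damp q unit_step t \<and>
      p * (unit_step \<star> damp p J) t = (unit_step \<star> damp p f) t - damp p J t" for n
    using AE_lborel_obtains_between[OF both, of "real n" "real n + 1"] by auto
  then obtain X where X: "\<And>n. real n < X n" "\<And>n. \<bar>damp p J (X n)\<bar> \<le> 2 * C * damp q unit_step (X n)"
      "\<And>n. p * (unit_step \<star> damp p J) (X n) = (unit_step \<star> damp p f) (X n) - damp p J (X n)"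
    by metis
  have X_top: "filterlim X at_top sequentially"
    by (rule filterlim_at_top_mono[OF filterlim_real_sequentially]) (simp add: X(1) less_imp_le)
  have "((\<lambda>T. \<integral>s. indicator {..T} s *\<^sub>R damp p J s \<partial>lborel) \<longlongrightarrow> (\<integral>s. damp p J s \<partial>lborel)) at_top"
    by (rule tendsto_integral_at_top[OF _ int]) simp
  moreover have "(\<integral>s. indicator {..T} s *\<^sub>R damp p J s \<partial>lborel) = (unit_step \<star> damp p J) T" for T
    unfolding unit_step_convolution[OF causal_damp[OF J]]
  proof (rule integral_cong_AE)
    show "AE s in lborel. indicator {..T} s *\<^sub>R damp p J s = indicator {..<T} s * damp p J s"
      using AE_lborel_singleton[of T] by eventually_elim (simp add: indicator_def)
  qed measurable
  ultimately have "(\<lambda>n. (unit_step \<star> damp p J) (X n)) \<longlonglongrightarrow> (\<integral>s. damp p J s \<partial>lborel)"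
    using filterlim_compose[OF _ X_top] by simp
  then have 1: "(\<lambda>n. p * (unit_step \<star> damp p J) (X n)) \<longlonglongrightarrow> p * (\<integral>s. damp p J s \<partial>lborel)"
    by (intro tendsto_intros)
  have "(\<lambda>n. 2 * C * exp (- q * X n)) \<longlonglongrightarrow> 0"
    by (rule tendsto_mult_right_zero[OF filterlim_compose[OF exp_decay[OF q] X_top]])
  then have "(\<lambda>n. damp p J (X n)) \<longlonglongrightarrow> 0"
  proof (rule Lim_null_comparison[rotated])
    show "eventually (\<lambda>n. norm (damp p J (X n)) \<le> 2 * C * exp (- q * X n)) sequentially"
    proof (rule always_eventually, rule allI)
      fix n
      have "0 < X n" using X(1)[of n] of_nat_0_le_iff[of n] by linarith
      then show "norm (damp p J (X n)) \<le> 2 * C * exp (- q * X n)"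
        using X(2)[of n] by (simp add: damp_def unit_step_def)
    qed
  qed
  then have "(\<lambda>n. (unit_step \<star> damp p f) (X n) - damp p J (X n)) \<longlonglongrightarrow> L p - 0"
    by (intro tendsto_diff filterlim_compose[OF conv[OF \<open>0 < p\<close>] X_top])
  with 1 have "p * (\<integral>s. damp p J s \<partial>lborel) = L p"
    unfolding X(3) using LIMSEQ_unique by fastforce
  then show "(\<integral>t. damp p (unit_step \<star> f) t \<partial>lborel) = L p / p"
    using \<open>0 < p\<close> by (simp add: J_def field_simps)
qed

section \<open>Uniqueness\<close>

text \<open>
  The primitive $P$ of $k = f - g$ is continuous, so it vanishes everywhere once it vanishes almost
  everywhere. Then $k$ has integral zero over every bounded interval that starts at $0$, hence over
  all rays after truncation.
\<close>
lemma AE_eq_if_primitives_AE_eq: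
  assumes f: "causal f" and g: "causal g"
    and eq: "AE t in lborel. (unit_step \<star> f) t = (unit_step \<star> g) t"
  shows "AE t in lborel. f t = g t"
proof -
  note [measurable] = causalD(1)[OF f] causalD(1)[OF g]
  define k where "k t = f t - g t" for t
  have [measurable]: "k \<in> borel_measurable borel" unfolding k_def by measurable
  have k: "integrable lborel (trunc a k)" for a
    using Bochner_Integration.integrable_diff[OF causalD(3)[OF f, of a] causalD(3)[OF g, of a]]
    by (simp add: k_def right_diff_distrib)
  define P where "P t = (\<integral>s. trunc t k s \<partial>lborel)" for t
  have "P t = (unit_step \<star> f) t - (unit_step \<star> g) t" for t
    using Bochner_Integration.integral_diff[OF causalD(3)[OF f, of t] causalD(3)[OF g, of t]]
    by (simp add: P_def k_def right_diff_distrib unit_step_convolution[OF f] unit_step_convolution[OF g])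
  with eq have P_AE: "AE t in lborel. P t = 0" by simp
  have closed: "P t = (\<integral>s. indicator {..t} s * k s \<partial>lborel)" for t
    unfolding P_def
  proof (rule integral_cong_AE)
    show "AE s in lborel. trunc t k s = indicator {..t} s * k s"
      using AE_lborel_singleton[of t] by eventually_elim (auto simp: indicator_def)
  qed measurable
  \<comment> \<open>Approach $t$ from the right through zeros of $P$.\<close>
  have P0: "P t = 0" for t
  proof -
    have "\<exists>s. t < s \<and> s < t + 1 / real (Suc n) \<and> P s = 0" for n
      by (rule AE_lborel_obtains_between[OF P_AE, of t "t + 1 / real (Suc n)"]) (simp, blast)
    then obtain X where X: "\<And>n. t < X n" "\<And>n. X n < t + 1 / real (Suc n)" "\<And>n. P (X n) = 0"
      by metis
    have X_lim: "X \<longlonglongrightarrow> t"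
    proof (rule tendsto_sandwich[of "\<lambda>n. t" _ _ "\<lambda>n. t + 1 / real (Suc n)"])
      have "(\<lambda>n. t + 1 / real (Suc n)) \<longlonglongrightarrow> t + 0"
        by (intro tendsto_add tendsto_const LIMSEQ_Suc[OF lim_1_over_n])
      then show "(\<lambda>n. t + 1 / real (Suc n)) \<longlonglongrightarrow> t" by simp
    qed (auto intro!: always_eventually less_imp_le X(1) X(2)[simplified])
    have "(\<lambda>n. P (X n)) \<longlonglongrightarrow> (\<integral>s. indicator {..t} s * k s \<partial>lborel)"
      unfolding P_def
    proof (rule integral_dominated_convergence)
      show "integrable lborel (\<lambda>s. norm (trunc (t + 1) k s))"
        by (intro integrable_norm k)
      show "AE s in lborel. (\<lambda>n. trunc (X n) k s) \<longlonglongrightarrow> indicator {..t} s * k s"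
      proof (rule AE_I2)
        fix s
        show "(\<lambda>n. trunc (X n) k s) \<longlonglongrightarrow> indicator {..t} s * k s"
        proof (cases "s \<le> t")
          case True
          then have "trunc (X n) k s = indicator {..t} s * k s" for n
            using X(1)[of n] by simp
          then show ?thesis by (simp only: tendsto_const)
        next
          case False
          then have "eventually (\<lambda>n. X n < s) sequentially"
            using X_lim by (intro order_tendstoD(2)) auto
          then have "eventually (\<lambda>n. trunc (X n) k s = indicator {..t} s * k s) sequentially"
            by eventually_elim (use False in simp)
          then show ?thesis by (rule tendsto_eventually)
        qed
      qed
      fix n
      have "X n < t + 1"
        using X(2)[of n] by (rule less_le_trans) simp
      then show "AE s in lborel. norm (trunc (X n) k s) \<le> norm (trunc (t + 1) k s)"
        by (intro AE_I2) (auto simp: indicator_def)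
    qed measurable
    then show ?thesis
      by (simp add: X(3) closed[of t] LIMSEQ_const_iff)
  qed
  have "AE t in lborel. \<forall>n::nat. trunc n k t = 0"
    unfolding AE_all_countable
  proof (rule allI, rule AE_zero_if_integrals_over_rays_zero[OF k])
    fix n :: nat and x :: real
    show "(\<integral>t. indicator {x<..} t * trunc n k t \<partial>lborel) = 0"
    proof (cases "x < n")
      case True
      have i: "integrable lborel (\<lambda>s. indicator {..x} s * k s)"
        using integrable_mult_indicator[OF _ k[of "x + 1"], of "{..x}"]
        by (rule Bochner_Integration.integrable_cong[THEN iffD1, rotated 2]) (auto simp: indicator_def)
      have "(\<lambda>t. indicator {x<..} t * trunc n k t) = (\<lambda>t. trunc n k t - indicator {..x} t * k t)"
        using True by (auto simp: indicator_def)
      then show ?thesis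
        using Bochner_Integration.integral_diff[OF k[of n] i] P0[of n] P0[of x] closed[of x] by (simp add: P_def)
    next
      case False
      then have "(\<lambda>t. indicator {x<..} t * trunc n k t) = (\<lambda>t. 0)"
        by (auto simp: indicator_def)
      then show ?thesis by simp
    qed
  qed
  then show ?thesis
  proof eventually_elim
    case (elim t)
    obtain n :: nat where "t < n" using reals_Archimedean2 by blast
    then show ?case using elim[rule_format, of n] by (simp add: k_def)
  qed
qed

text \<open>
  Lerch's theorem. In the variable $y = e^{-t}$, which lies in $(0,1)$ for $t > 0$, the hypothesis says
  that $w$ is orthogonal to all polynomials. By the Weierstrass approximation theorem it is orthogonal
  to all continuous functions of $y$, and by dominated convergence to the indicator functions of
  $y < e^{-x}$, that is, of the rays $t > x$.
\<close>
lemma AE_zero_if_laplace_at_naturals_zero: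
  assumes w: "integrable lborel w" and w0: "\<And>t. t \<le> 0 \<Longrightarrow> w t = 0"
    and zero: "\<And>n::nat. (\<integral>t. damp n w t \<partial>lborel) = 0"
  shows "AE t in lborel. w t = 0"
proof (rule AE_zero_if_integrals_over_rays_zero[OF w])
  have [measurable]: "w \<in> borel_measurable borel" using w by auto
  have bdd: "integrable lborel (\<lambda>t. \<phi> (exp (- t)) * w t)"
    if [measurable]: "\<phi> \<in> borel_measurable borel" and "\<And>x. 0 \<le> x \<Longrightarrow> x \<le> 1 \<Longrightarrow> \<bar>\<phi> x\<bar> \<le> B" for \<phi> B
  proof (rule Bochner_Integration.integrable_bound)
    show "integrable lborel (\<lambda>t. B * w t)" by (intro integrable_mult_right w)
    have "\<bar>\<phi> (exp (- t)) * w t\<bar> \<le> \<bar>B * w t\<bar>" for t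
    proof (cases "t \<le> 0")
      case False
      then have "\<bar>\<phi> (exp (- t))\<bar> \<le> \<bar>B\<bar>" using that(2)[of "exp (- t)"] by simp
      then show ?thesis by (simp add: abs_mult mult_right_mono)
    qed (simp add: w0)
    then show "AE t in lborel. norm (\<phi> (exp (- t)) * w t) \<le> norm (B * w t)" by simp
  qed measurable
  have powers: "integrable lborel (\<lambda>t. exp (- t) ^ n * w t)" "(\<integral>t. exp (- t) ^ n * w t \<partial>lborel) = 0" for n
  proof -
    show "integrable lborel (\<lambda>t. exp (- t) ^ n * w t)"
      by (rule bdd[of "\<lambda>x. x ^ n" 1]) (auto simp: power_le_one)
    have "exp (- t) ^ n * w t = damp n w t" for t
      by (simp add: damp_def exp_of_nat_mult[symmetric])
    then show "(\<integral>t. exp (- t) ^ n * w t \<partial>lborel) = 0"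
      using zero[of n] by simp
  qed
  have cont: "(\<integral>t. \<phi> (exp (- t)) * w t \<partial>lborel) = 0"
    if \<phi>: "continuous_on UNIV \<phi>" and b: "\<And>x. \<bar>\<phi> x\<bar> \<le> 1" for \<phi>
  proof -
    have [measurable]: "\<phi> \<in> borel_measurable borel" by (rule borel_measurable_continuous_onI[OF \<phi>])
    have i: "integrable lborel (\<lambda>t. \<phi> (exp (- t)) * w t)" by (rule bdd[of _ 1]) (auto intro: b)
    have "\<bar>\<integral>t. \<phi> (exp (- t)) * w t \<partial>lborel\<bar> \<le> e * (\<integral>t. \<bar>w t\<bar> \<partial>lborel)" if "0 < e" for e
    proof -
      obtain h where "real_polynomial_function h" and h: "\<And>x. x \<in> {0..1} \<Longrightarrow> \<bar>\<phi> x - h x\<bar> < e"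
        using Stone_Weierstrass_real_polynomial_function[of "{0..1::real}" \<phi> e] continuous_on_subset[OF \<phi>] \<open>0 < e\<close>
        by auto
      then obtain a n where a: "h = (\<lambda>x. \<Sum>i\<le>n. a i * x ^ i)"
        using real_polynomial_function_iff_sum by blast
      have h_eq: "h (exp (- t)) * w t = (\<Sum>i\<le>n. a i * (exp (- t) ^ i * w t))" for t
        by (simp add: a sum_distrib_right mult.assoc)
      have hi: "integrable lborel (\<lambda>t. h (exp (- t)) * w t)"
        unfolding h_eq by (intro Bochner_Integration.integrable_sum integrable_mult_right powers)
      have h0: "(\<integral>t. h (exp (- t)) * w t \<partial>lborel) = 0"
        unfolding h_eq using powers
        by (subst Bochner_Integration.integral_sum) (auto intro!: integrable_mult_right simp: powers)
      have "\<bar>\<integral>t. \<phi> (exp (- t)) * w t \<partial>lborel\<bar> = \<bar>\<integral>t. \<phi> (exp (- t)) * w t - h (exp (- t)) * w t \<partial>lborel\<bar>"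
        using Bochner_Integration.integral_diff[OF i hi] h0 by simp
      also have "\<dots> \<le> (\<integral>t. e * \<bar>w t\<bar> \<partial>lborel)"
      proof (rule integral_abs_bound_integral)
        show "integrable lborel (\<lambda>t. \<phi> (exp (- t)) * w t - h (exp (- t)) * w t)"
          by (intro Bochner_Integration.integrable_diff i hi)
        show "integrable lborel (\<lambda>t. e * \<bar>w t\<bar>)"
          by (intro integrable_mult_right integrable_abs w)
        show "\<bar>\<phi> (exp (- t)) * w t - h (exp (- t)) * w t\<bar> \<le> e * \<bar>w t\<bar>" for t
        proof (cases "t \<le> 0")
          case False
          then have "\<bar>\<phi> (exp (- t)) - h (exp (- t))\<bar> \<le> e"
            by (intro less_imp_le h) simp
          then show ?thesis
            by (simp add: left_diff_distrib[symmetric] abs_mult mult_right_mono)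
        qed (simp add: w0)
      qed
      also have "\<dots> = e * (\<integral>t. \<bar>w t\<bar> \<partial>lborel)" by simp
      finally show ?thesis .
    qed
    note small = this
    show ?thesis
    proof (rule ccontr)
      let ?I = "\<integral>t. \<phi> (exp (- t)) * w t \<partial>lborel" and ?N = "\<integral>t. \<bar>w t\<bar> \<partial>lborel"
      assume "?I \<noteq> 0"
      then have I: "0 < \<bar>?I\<bar>" by simp
      have "0 \<le> ?N" by simp
      then have N: "0 < ?N + 1" by linarith
      \<comment> \<open>The divisor $N + 1$, rather than $N$, covers the case $N = 0$.\<close>
      have "\<bar>?I\<bar> \<le> \<bar>?I\<bar> / (?N + 1) * ?N"
        by (rule small, rule divide_pos_pos[OF I]) (rule N)
      also have "\<dots> < \<bar>?I\<bar>"
        using I by (simp add: pos_divide_less_eq[OF N] distrib_left)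
      finally show False by simp
    qed
  qed
  fix x :: real
  \<comment> \<open>Continuous functions of $y$ that increase to the indicator function of $y < e^{-x}$.\<close>
  define \<phi> where "\<phi> k y = min 1 (max 0 (real k * (exp (- x) - y)))" for k y
  have \<phi>1: "\<bar>\<phi> k y\<bar> \<le> 1" for k y by (simp add: \<phi>_def)
  have \<phi>c: "continuous_on UNIV (\<phi> k)" for k
    unfolding \<phi>_def by (intro continuous_intros)
  have [measurable]: "\<phi> k \<in> borel_measurable borel" for k
    by (rule borel_measurable_continuous_onI[OF \<phi>c])
  have "(\<lambda>k. \<integral>t. \<phi> k (exp (- t)) * w t \<partial>lborel) \<longlonglongrightarrow> (\<integral>t. indicator {x<..} t * w t \<partial>lborel)"
  proof (rule integral_dominated_convergence[where w="\<lambda>t. \<bar>w t\<bar>"])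
    show "integrable lborel (\<lambda>t. \<bar>w t\<bar>)" by (intro integrable_abs w)
    show "AE t in lborel. norm (\<phi> k (exp (- t)) * w t) \<le> \<bar>w t\<bar>" for k
      using \<phi>1 by (auto simp: abs_mult intro!: mult_left_le_one_le)
    show "AE t in lborel. (\<lambda>k. \<phi> k (exp (- t)) * w t) \<longlonglongrightarrow> indicator {x<..} t * w t"
    proof (rule AE_I2, rule tendsto_mult[OF _ tendsto_const])
      fix t
      show "(\<lambda>k. \<phi> k (exp (- t))) \<longlonglongrightarrow> indicator {x<..} t"
      proof (cases "x < t")
        case True
        then have d: "0 < exp (- x) - exp (- t)" by simp
        obtain N :: nat where N: "1 < real N * (exp (- x) - exp (- t))"
          using ex_less_of_nat_mult[OF d] by blast
        have "eventually (\<lambda>k. \<phi> k (exp (- t)) = 1) sequentially"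
          using eventually_ge_at_top[of N]
        proof eventually_elim
          case (elim k)
          then have "real N * (exp (- x) - exp (- t)) \<le> real k * (exp (- x) - exp (- t))"
            using d by (intro mult_right_mono) auto
          with N show ?case by (simp add: \<phi>_def)
        qed
        then show ?thesis using True by (simp add: tendsto_eventually)
      next
        case False
        then have nonpos: "real k * (exp (- x) - exp (- t)) \<le> 0" for k
          by (intro mult_nonneg_nonpos) auto
        have "\<phi> k (exp (- t)) = 0" for k
          unfolding \<phi>_def max_absorb1[OF nonpos] by simp
        then show ?thesis using False by simp
      qed
    qed
  qed measurable
  then show "(\<integral>t. indicator {x<..} t * w t \<partial>lborel) = 0"
    by (simp add: cont[OF \<phi>c \<phi>1] LIMSEQ_const_iff)
qed

text \<open>
  The transform of $f * g$ itself may diverge, so the comparison is made between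
  $u = (1 * f) * (1 * g)$ and $v = 1 * (1 * h)$, whose transforms converge absolutely to
  $F(p) G(p) / p^2$.
\<close>
lemma convolution_unique_by_laplace:
  assumes f: "causal f" and g: "causal g" and h: "causal h"
    and F: "\<And>p. 0 < p \<Longrightarrow> ((\<lambda>T. (unit_step \<star> damp p f) T) \<longlongrightarrow> F p) at_top"
    and G: "\<And>p. 0 < p \<Longrightarrow> ((\<lambda>T. (unit_step \<star> damp p g) T) \<longlongrightarrow> G p) at_top"
    and FG: "\<And>p. 0 < p \<Longrightarrow> ((\<lambda>T. (unit_step \<star> damp p h) T) \<longlongrightarrow> F p * G p) at_top"
  shows "AE t in lborel. (f \<star> g) t = h t"
proof -
  note H = causal_unit_step
  define u where "u = (unit_step \<star> f) \<star> (unit_step \<star> g)"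
  define v where "v = unit_step \<star> (unit_step \<star> h)"
  have u: "causal u" and v: "causal v"
    unfolding u_def v_def by (intro causal_line_convolution H f g h)+
  have "integrable lborel (damp p u) \<and> integrable lborel (damp p v) \<and>
      (\<integral>t. damp p u t \<partial>lborel) = (\<integral>t. damp p v t \<partial>lborel)" if "0 < p" for p
  proof -
    note i = integrable_damp_primitive[OF f F \<open>0 < p\<close>] integrable_damp_primitive[OF g G \<open>0 < p\<close>]
      integrable_damp_primitive[OF h FG \<open>0 < p\<close>] damp_unit_step_integral(1)[OF \<open>0 < p\<close>]
    note e = laplace_primitive[OF f F \<open>0 < p\<close>] laplace_primitive[OF g G \<open>0 < p\<close>]
      laplace_primitive[OF h FG \<open>0 < p\<close>] damp_unit_step_integral(2)[OF \<open>0 < p\<close>]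
    show ?thesis
      unfolding u_def v_def damp_line_convolution[of p "unit_step \<star> f"] damp_line_convolution[of p unit_step "unit_step \<star> h"]
      using integrable_line_convolution[OF i(1,2)] integrable_line_convolution[OF i(4,3)]
      by (simp add: integral_line_convolution[OF i(1,2)] integral_line_convolution[OF i(4,3)] e)
  qed
  note uv = this
  \<comment> \<open>One factor $e^{-t}$ makes the difference integrable; the transforms at $1 + n$ remain available.\<close>
  define w where "w t = damp 1 u t - damp 1 v t" for t
  have "AE t in lborel. w t = 0"
  proof (rule AE_zero_if_laplace_at_naturals_zero)
    show "integrable lborel w"
      unfolding w_def[abs_def] using uv[OF zero_less_one]
      by (intro Bochner_Integration.integrable_diff) blast+
    show "w t = 0" if "t \<le> 0" for t
      using causalD(2)[OF u that] causalD(2)[OF v that] by (simp add: w_def damp_def)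
    fix n :: nat
    have "damp n w t = damp (1 + real n) u t - damp (1 + real n) v t" for t
    proof -
      have e: "exp (- (1 + real n) * t) = exp (- real n * t) * exp (- 1 * t)"
        by (simp add: exp_add[symmetric] algebra_simps)
      show ?thesis
        unfolding w_def damp_def e by (simp only: right_diff_distrib mult.assoc)
    qed
    moreover have "0 < 1 + real n" by simp
    ultimately show "(\<integral>t. damp n w t \<partial>lborel) = 0"
      using uv[of "1 + real n"] by simp
  qed
  moreover have "AE t in lborel. u t = (unit_step \<star> (unit_step \<star> (f \<star> g))) t"
  proof -
    have fJ: "causal (f \<star> (unit_step \<star> g))" and fg: "causal (f \<star> g)" and Jfg: "causal (unit_step \<star> (f \<star> g))"
      by (intro causal_line_convolution f g H)+
    have "AE t in lborel. (f \<star> (unit_step \<star> g)) t = (unit_step \<star> (f \<star> g)) t"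
      using causal_line_convolution_assoc[OF f g H]
      by (simp only: line_convolution_commute[of _ unit_step])
    then have "(f \<star> (unit_step \<star> g)) \<star> unit_step = (unit_step \<star> (f \<star> g)) \<star> unit_step"
      by (rule line_convolution_cong_AE[OF causalD(1)[OF fJ] causalD(1)[OF Jfg] causalD(1)[OF H]])
    then have "unit_step \<star> (f \<star> (unit_step \<star> g)) = unit_step \<star> (unit_step \<star> (f \<star> g))"
      by (simp only: line_convolution_commute[of _ unit_step])
    with causal_line_convolution_assoc[OF H f causal_line_convolution[OF H g]]
    have "AE t in lborel. (unit_step \<star> (unit_step \<star> (f \<star> g))) t = u t"
      by (simp only: u_def)
    then show ?thesis by eventually_elim (rule sym)
  qed
  ultimately have "AE t in lborel. (unit_step \<star> (unit_step \<star> (f \<star> g))) t = (unit_step \<star> (unit_step \<star> h)) t"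
  proof eventually_elim
    case (elim t)
    have "u t = v t" using elim(1) by (simp add: w_def damp_def)
    with elim(2) show ?case by (simp only: v_def)
  qed
  then have "AE t in lborel. (unit_step \<star> (f \<star> g)) t = (unit_step \<star> h) t"
    by (rule AE_eq_if_primitives_AE_eq[rotated 2]) (intro causal_line_convolution f g h H)+
  then show ?thesis
    by (rule AE_eq_if_primitives_AE_eq[rotated 2]) (intro causal_line_convolution f g h)+
qed

section \<open>Borel representatives\<close>

lemma lebesgue_integral_eq_lborel:
  fixes u v :: "real \<Rightarrow> real"
  assumes u: "u \<in> borel_measurable borel" and eq: "AE t in lebesgue. v t = u t"
  shows "integrable lebesgue v \<longleftrightarrow> integrable lborel u" "(\<integral>t. v t \<partial>lebesgue) = (\<integral>t. u t \<partial>lborel)"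
proof -
  have u': "u \<in> borel_measurable lebesgue" using u by (intro measurable_completion) simp
  have v: "v \<in> borel_measurable lebesgue"
  proof (rule measurableI)
    fix A :: "real set" assume A: "A \<in> sets borel"
    show "v -` A \<inter> space lebesgue \<in> sets lebesgue"
    proof (rule complete_measure.in_sets_AE[OF _ _ measurable_sets[OF u' A]])
      show "AE t in lebesgue. (t \<in> u -` A \<inter> space lebesgue) = (t \<in> v -` A \<inter> space lebesgue)"
        using eq by eventually_elim auto
    qed (auto intro: completion.complete_measure_axioms)
  qed simp
  show "integrable lebesgue v \<longleftrightarrow> integrable lborel u"
    using integrable_cong_AE[OF v u' eq] integrable_completion[of u lborel] u by simp
  show "(\<integral>t. v t \<partial>lebesgue) = (\<integral>t. u t \<partial>lborel)"
    using integral_cong_AE[OF v u' eq] integral_completion[of u lborel] u by simp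
qed

definition represents :: "(real \<Rightarrow> real) \<Rightarrow> (real \<Rightarrow> real) \<Rightarrow> bool" where
  "represents f' f \<longleftrightarrow> causal f' \<and> (AE t in lebesgue. 0 < t \<longrightarrow> f t = f' t)"

text \<open>
  Every Lebesgue measurable function agrees almost everywhere with a Borel function. The product of
  $f$ with the indicator function of the half-line is measurable as a pointwise limit of its
  restrictions to bounded intervals.
\<close>
lemma represents_exists:
  assumes "locally_integrable f"
  obtains f' where "represents f' f"
proof -
  have int: "integrable lebesgue (\<lambda>t. indicator {0<..<a} t *\<^sub>R f t)" if "0 < a" for a
    using assms that by (auto simp: locally_integrable_def set_integrable_def)
  have "(\<lambda>t. indicator {0<..} t * f t) \<in> borel_measurable lebesgue"
  proof (rule borel_measurable_LIMSEQ_real)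
    fix n :: nat
    show "(\<lambda>t. indicator {0<..<real (Suc n)} t *\<^sub>R f t) \<in> borel_measurable lebesgue"
      by (rule borel_measurable_integrable[OF int]) simp
  next
    fix t :: real
    obtain N :: nat where N: "t < real N" using reals_Archimedean2 by blast
    have "eventually (\<lambda>n. indicator {0<..<real (Suc n)} t *\<^sub>R f t = indicator {0<..} t * f t) sequentially"
      using eventually_ge_at_top[of N] by eventually_elim (use N in \<open>auto simp: indicator_def\<close>)
    then show "(\<lambda>n. indicator {0<..<real (Suc n)} t *\<^sub>R f t) \<longlonglongrightarrow> indicator {0<..} t * f t"
      by (rule tendsto_eventually)
  qed
  from completion_ex_borel_measurable_real[OF this]
  obtain g where g: "g \<in> borel_measurable borel" and eq: "AE t in lborel. indicator {0<..} t * f t = g t"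
    by auto
  note [measurable] = g
  define f' where "f' t = indicator {0<..} t * g t" for t
  have [measurable]: "f' \<in> borel_measurable borel" unfolding f'_def by measurable
  have eq': "AE t in lebesgue. 0 < t \<longrightarrow> f t = f' t"
    using AE_completion[OF eq] by eventually_elim (auto simp: f'_def)
  have f'0: "f' t = 0" if "t \<le> 0" for t using that by (simp add: f'_def)
  have "integrable lborel (trunc a f')" for a
  proof (cases "0 < a")
    case True
    have "AE t in lebesgue. indicator {0<..<a} t *\<^sub>R f t = trunc a f' t"
      using eq' by eventually_elim (auto simp: indicator_def f'0)
    then show ?thesis
      using lebesgue_integral_eq_lborel(1)[of "trunc a f'" "\<lambda>t. indicator {0<..<a} t *\<^sub>R f t"] int[OF True]
      by simp
  next
    case False
    then have "trunc a f' = (\<lambda>t. 0)" using f'0 by (auto simp: indicator_def)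
    then show ?thesis by simp
  qed
  then have "represents f' f" using eq' f'0 by (auto simp: represents_def causal_def)
  then show thesis by (rule that)
qed

lemma represents_self:
  "causal f \<Longrightarrow> represents f f"
  by (simp add: represents_def)

lemma locally_integrable_causal:
  assumes f: "causal f"
  shows "locally_integrable f"
  unfolding locally_integrable_def set_integrable_def
proof (intro allI impI)
  fix a :: real
  have "AE t in lebesgue. indicator {0<..<a} t *\<^sub>R f t = trunc a f t"
    using causalD(2)[OF f] by (auto simp: indicator_def not_less)
  then show "integrable lebesgue (\<lambda>t. indicator {0<..<a} t *\<^sub>R f t)"
    using lebesgue_integral_eq_lborel(1)[of "trunc a f"] causalD(1,3)[OF f] by simp
qed

text \<open>
  The integrands agree for almost every $s$. For the reflected factor $f(t-s)$ this uses that the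
  exceptional set lies in a Borel null set, whose reflection is again null.
\<close>
lemma convolution_represents:
  assumes "represents f' f" and "represents g' g"
  shows "convolution f g = f' \<star> g'"
proof
  fix t
  have f': "causal f'" and g': "causal g'"
    and ff: "AE s in lborel. 0 < s \<longrightarrow> f s = f' s" and gg: "AE s in lebesgue. 0 < s \<longrightarrow> g s = g' s"
    using assms by (auto simp: represents_def AE_completion_iff)
  note [measurable] = causalD(1)[OF f'] causalD(1)[OF g']
  obtain N where N: "\<And>s. s \<in> space lborel - N \<Longrightarrow> 0 < s \<longrightarrow> f s = f' s" "N \<in> null_sets lborel"
    using AE_E3[OF ff] by blast
  have [measurable]: "N \<in> sets borel" using N(2) by auto
  have "AE s in lborel. t + (-1) * s \<notin> N"
    by (rule AE_borel_affine) (use AE_not_in[OF N(2)] in auto)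
  then have "AE s in lebesgue. t - s \<notin> N" by (intro AE_completion) simp
  then have "AE s in lebesgue. indicator {0<..<t} s *\<^sub>R (f (t - s) * g s) = f' (t - s) * g' s"
    using gg
  proof eventually_elim
    case (elim s)
    then show ?case
      using N(1)[of "t - s"] causalD(2)[OF f', of "t - s"] causalD(2)[OF g', of s]
      by (auto simp: indicator_def)
  qed
  then show "convolution f g t = (f' \<star> g') t"
    unfolding convolution_def line_convolution_def set_lebesgue_integral_def
    by (rule lebesgue_integral_eq_lborel(2)[rotated]) measurable
qed

lemma has_laplace_represents:
  assumes "represents f' f" and "has_laplace f p L"
  shows "((\<lambda>T. (unit_step \<star> damp p f') T) \<longlongrightarrow> L) at_top"
proof -
  have f': "causal f'" and ff: "AE s in lebesgue. 0 < s \<longrightarrow> f s = f' s"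
    using assms by (auto simp: represents_def)
  note D = causal_damp[OF f', of p]
  note [measurable] = causalD(1)[OF D]
  have "(LINT t:{0<..<T}|lebesgue. exp (- p * t) * f t) = (unit_step \<star> damp p f') T" for T
    unfolding set_lebesgue_integral_def unit_step_convolution[OF D]
  proof (rule lebesgue_integral_eq_lborel(2))
    show "AE t in lebesgue. indicator {0<..<T} t *\<^sub>R (exp (- p * t) * f t) = trunc T (damp p f') t"
      using ff
    proof eventually_elim
      case (elim t)
      then show ?case
        using causalD(2)[OF f', of t] by (auto simp: indicator_def damp_def)
    qed
  qed measurable
  then show ?thesis using assms(2) by (simp add: has_laplace_def)
qed

lemma locally_integrable_eqI:
  assumes "represents f' f" and "locally_integrable f" and "causal g" and "AE t in lborel. g t = f' t"
  shows "locally_integrable_eq g f"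
proof -
  have "AE t in lebesgue. 0 < t \<longrightarrow> g t = f t"
    using AE_completion[OF assms(4)] assms(1)[unfolded represents_def, THEN conjunct2]
    by eventually_elim auto
  then show ?thesis
    using assms locally_integrable_causal by (auto simp: locally_integrable_eq_def)
qed

lemma memory_integral_eq_convolution: "memory_integral \<Psi> \<gamma> x = convolution (\<Psi> \<gamma>) x"
  by (rule ext) (simp add: memory_integral_def convolution_def)


section \<open>The semigroup property\<close>

theorem theorem3p1:
  fixes \<Phi> :: "real \<Rightarrow> 'm \<Rightarrow> real" and \<Theta> :: 'm
    and \<Psi> :: "real \<Rightarrow> real \<Rightarrow> real" and \<alpha> \<beta> :: real
  assumes "memory_generator \<Phi> \<Theta>"
    and "\<And>\<gamma>. \<gamma> > 0 \<Longrightarrow> memory_kernel \<Phi> \<Theta> \<gamma> (\<Psi> \<gamma>)"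
    and "\<alpha> > 0" and "\<beta> > 0"
  shows "locally_integrable_eq (convolution (\<Psi> \<alpha>) (\<Psi> \<beta>)) (\<Psi> (\<alpha> + \<beta>)) \<and>
    (\<forall>x. locally_integrable x \<longrightarrow>
       locally_integrable_eq
         (memory_integral \<Psi> \<alpha> (memory_integral \<Psi> \<beta> x)) (memory_integral \<Psi> (\<alpha> + \<beta>) x)) \<and>
    (\<forall>x. locally_integrable x \<longrightarrow>
       locally_integrable_eq
         (memory_integral \<Psi> \<alpha> (memory_integral \<Psi> \<beta> x))
         (memory_integral \<Psi> \<beta> (memory_integral \<Psi> \<alpha> x)))"
proof -
  have loc: "locally_integrable (\<Psi> \<gamma>)"
    and lap: "0 < p \<Longrightarrow> has_laplace (\<Psi> \<gamma>) p (\<Phi> p \<Theta> powr (- \<gamma>))" if "0 < \<gamma>" for \<gamma> p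
    using assms(2)[OF that] by (auto simp: memory_kernel_def)
  have kernels: "AE t in lborel. (a \<star> b) t = c t"
    if "0 < \<gamma>" "0 < \<delta>" "represents a (\<Psi> \<gamma>)" "represents b (\<Psi> \<delta>)" "represents c (\<Psi> (\<gamma> + \<delta>))" for \<gamma> \<delta> a b c
  proof (rule convolution_unique_by_laplace)
    show "((\<lambda>T. (unit_step \<star> damp p c) T) \<longlongrightarrow> \<Phi> p \<Theta> powr (- \<gamma>) * \<Phi> p \<Theta> powr (- \<delta>)) at_top"
      if "0 < p" for p
      using has_laplace_represents[OF \<open>represents c _\<close> lap[OF _ that]] \<open>0 < \<gamma>\<close> \<open>0 < \<delta>\<close>
      by (simp add: powr_add[symmetric] add.commute)
  qed (use that in \<open>auto simp: represents_def intro: has_laplace_represents lap\<close>)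
  have semigroup: "locally_integrable_eq (memory_integral \<Psi> \<gamma> (memory_integral \<Psi> \<delta> x)) (memory_integral \<Psi> (\<gamma> + \<delta>) x)"
    if pos: "0 < \<gamma>" "0 < \<delta>" and x: "locally_integrable x" for \<gamma> \<delta> x
  proof -
    obtain a where a: "represents a (\<Psi> \<gamma>)" by (rule represents_exists[OF loc[OF pos(1)]])
    obtain b where b: "represents b (\<Psi> \<delta>)" by (rule represents_exists[OF loc[OF pos(2)]])
    obtain c where c: "represents c (\<Psi> (\<gamma> + \<delta>))"
      by (rule represents_exists[OF loc[OF add_pos_pos[OF pos]]])
    obtain y where y: "represents y x" by (rule represents_exists[OF x])
    note r = a b c y
    then have C: "causal a" "causal b" "causal c" "causal y"
      by (auto simp: represents_def)
    have inner: "memory_integral \<Psi> \<delta> x = b \<star> y"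
      unfolding memory_integral_eq_convolution by (rule convolution_represents[OF r(2,4)])
    have lhs: "memory_integral \<Psi> \<gamma> (memory_integral \<Psi> \<delta> x) = a \<star> (b \<star> y)"
      unfolding inner memory_integral_eq_convolution[of _ \<gamma>]
      by (intro convolution_represents r represents_self causal_line_convolution C)
    have rhs: "memory_integral \<Psi> (\<gamma> + \<delta>) x = c \<star> y"
      unfolding memory_integral_eq_convolution by (rule convolution_represents[OF r(3,4)])
    have "(a \<star> b) \<star> y = c \<star> y"
      by (intro line_convolution_cong_AE kernels[OF pos r(1-3)] causalD(1) causal_line_convolution C)
    then have "AE t in lborel. (a \<star> (b \<star> y)) t = (c \<star> y) t"
      using causal_line_convolution_assoc[OF C(1,2,4)] by simp
    then show ?thesis
      unfolding lhs rhs
      by (intro locally_integrable_eqI[of "c \<star> y"] represents_self locally_integrable_causal causal_line_convolution C)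
  qed
  obtain a where a: "represents a (\<Psi> \<alpha>)" by (rule represents_exists[OF loc[OF assms(3)]])
  obtain b where b: "represents b (\<Psi> \<beta>)" by (rule represents_exists[OF loc[OF assms(4)]])
  obtain c where c: "represents c (\<Psi> (\<alpha> + \<beta>))"
    by (rule represents_exists[OF loc[OF add_pos_pos[OF assms(3,4)]]])
  note r = a b c
  have "locally_integrable_eq (convolution (\<Psi> \<alpha>) (\<Psi> \<beta>)) (\<Psi> (\<alpha> + \<beta>))"
    unfolding convolution_represents[OF r(1,2)]
    by (rule locally_integrable_eqI[OF r(3) loc])
      (use assms(3,4) r kernels[OF assms(3,4) r] in \<open>auto simp: represents_def intro: causal_line_convolution\<close>)
  moreover have "locally_integrable_eq (memory_integral \<Psi> \<alpha> (memory_integral \<Psi> \<beta> x))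
      (memory_integral \<Psi> \<beta> (memory_integral \<Psi> \<alpha> x))" if x: "locally_integrable x" for x
  proof -
    note 1 = semigroup[OF assms(3,4) x] and 2 = semigroup[OF assms(4,3) x]
    have "AE t in lebesgue. 0 < t \<longrightarrow> memory_integral \<Psi> \<alpha> (memory_integral \<Psi> \<beta> x) t
        = memory_integral \<Psi> \<beta> (memory_integral \<Psi> \<alpha> x) t"
      using 1[unfolded locally_integrable_eq_def, THEN conjunct2, THEN conjunct2]
        2[unfolded locally_integrable_eq_def, THEN conjunct2, THEN conjunct2]
      by eventually_elim (simp add: add.commute)
    with 1 2 show ?thesis by (simp add: locally_integrable_eq_def)
  qed
  ultimately show ?thesis
    using semigroup[OF assms(3,4)] by blast
qed

end
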